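(* Let $\gamma\ge 0$ and let $(\mathbf X,\mathbf Y)$ be a random element of $\mathbb R^d\times\{0,1\}^d$ such that $Y_i\perp Y_j\mid\mathbf X$ for any $i\ne j$, and such that the conditional probabilities $p_j(\mathbf X):=\mathbb P(Y_j=1\mid\mathbf X)$, $j=1,\dots,d$, are distinct with probability one. A segmentation rule $\boldsymbol\delta^*$ is a global maximizer of $\mathrm{Dice}_\gamma(\boldsymbol\delta)$ if and only if it satisfies $$\delta^*_j(\mathbf x)=\begin{cases}1 & \text{if } p_j(\mathbf x)\text{ ranks top }\tau^*(\mathbf x),\\ 0&\text{otherwise.}\end{cases}$$ The optimal volume (the optimum total number of segmented features) $\tau^*(\mathbf x)$ is given as $$\tau^*(\mathbf x)=\operatorname*{argmax}_{\tau\in\{0,1,\dots,d\}}\Big(\sum_{j\in J_\tau(\mathbf x)}\sum_{l=0}^{d-1}\frac{2}{\tau+l+\gamma+1}\,p_j(\mathbf x)\,\mathbb P\big(\Gamma_{-j}(\mathbf x)=l\big)+\sum_{l=0}^{d}\frac{\gamma}{\tau+l+\gamma}\,\mathbb P\big(\Gamma(\mathbf x)=l\big)\Big),$$ where $J_\tau(\mathbf x)=\{j:\sum_{j'=1}^d\mathbf 1(p_{j'}(\mathbf x)\ge p_j(\mathbf x))\le\tau\}$ is the index set of the $\tau$ largest conditional probabilities, with $J_0(\mathbf x)=\emptyset$, and $\Gamma(\mathbf x)=\sum_{j=1}^dB_j(\mathbf x)$ and $\Gamma_{-j}(\mathbf x)=\sum_{j'\ne j}B_{j'}(\mathbf x)$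 are Poisson-binomial random variables, $B_j(\mathbf x)$ being a Bernoulli random variable with success probability $p_j(\mathbf x)$.
   Context: A segmentation rule is a function $\boldsymbol\delta=(\delta_1,\dots,\delta_d)^\top:\mathbb R^d\to\{0,1\}^d$; here $\mathbf X\in\mathbb R^d$ is a feature vector and $\mathbf Y=(Y_1,\dots,Y_d)^\top\in\{0,1\}^d$ is its feature-wise label. The Dice metric with smoothing parameter $\gamma\ge0$ is $$\mathrm{Dice}_\gamma(\boldsymbol\delta)=\mathbb E\Big(\frac{2\mathbf Y^\top\boldsymbol\delta(\mathbf X)+\gamma}{\|\mathbf Y\|_1+\|\boldsymbol\delta(\mathbf X)\|_1+\gamma}\Big).$$ "$p_j(\mathbf x)$ ranks top $\tau$" means that $p_j(\mathbf x)$ is among the $\tau$ largest of $p_1(\mathbf x),\dots,p_d(\mathbf x)$. A Poisson-binomial random variable is a sum of independent, not necessarily identically distributed, Bernoulli random variables; so for each fixed $\mathbf x$ the variables $B_1(\mathbf x),\dots,B_d(\mathbf x)$ are independent.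
   Formalization: The labels are assumed mutually (not only pairwise) conditionally independent given X, as the claim fails for pairwise independence when d = 3; rules are Borel, the form of δ* holds for almost every x with some choice of τ*(x) in the argmax, and 0/0 = 0 when γ = 0. *)

theory Defs
  imports "HOL-Probability.Probability"
begin

definition l1_norm :: "real ^ 'n::finite \<Rightarrow> real" where
  "l1_norm v = (\<Sum>j\<in>UNIV. \<bar>v $ j\<bar>)"

definition binary_vectors :: "(real ^ 'n::finite) set" where
  "binary_vectors = {v. \<forall>j. v $ j \<in> {0, 1}}"

text \<open>Segmentation rules are Borel measurable, so that the expectation defining the Dice metric
  makes sense.\<close>

definition segmentation_rule :: "(real ^ 'n::finite \<Rightarrow> real ^ 'n) \<Rightarrow> bool" where
  "segmentation_rule \<delta> \<longleftrightarrow> \<delta> \<in> borel_measurable borel \<and> range \<delta> \<subseteq> binary_vectors"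

text \<open>For \<open>\<gamma> = 0\<close> the ratio below is \<open>0 / 0 = 0\<close> when both the label and the segmentation
  vanish. The convention \<open>0 / 0 = 0\<close> is likewise in force in \<open>volume_objective\<close>.\<close>

definition dice ::
  "'a measure \<Rightarrow> ('a \<Rightarrow> real ^ 'n::finite) \<Rightarrow> ('a \<Rightarrow> real ^ 'n) \<Rightarrow> real \<Rightarrow> (real ^ 'n \<Rightarrow> real ^ 'n) \<Rightarrow> real"
where
  "dice M X Y \<gamma> \<delta> =
     (LINT \<omega>|M. (2 * (Y \<omega> \<bullet> \<delta> (X \<omega>)) + \<gamma>) / (l1_norm (Y \<omega>) + l1_norm (\<delta> (X \<omega>)) + \<gamma>))"

definition sigma_gen :: "'a measure \<Rightarrow> ('a \<Rightarrow> 'b::topological_space) \<Rightarrow> 'a measure" where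
  "sigma_gen M X = vimage_algebra (space M) X borel"

definition cond_probability :: "'a measure \<Rightarrow> 'a measure \<Rightarrow> 'a set \<Rightarrow> 'a \<Rightarrow> real" where
  "cond_probability M F A = real_cond_exp M F (indicator A)"

text \<open>Conditional independence given the sub-sigma-algebra \<open>F\<close>, phrased in the same way as
  \<open>prob_space.indep_vars\<close>.\<close>

definition cond_indep_vars ::
  "'a measure \<Rightarrow> 'a measure \<Rightarrow> ('i \<Rightarrow> 'b measure) \<Rightarrow> ('i \<Rightarrow> 'a \<Rightarrow> 'b) \<Rightarrow> 'i set \<Rightarrow> bool"
where
  "cond_indep_vars M F N Z I \<longleftrightarrow>
     (\<forall>i\<in>I. Z i \<in> measurable M (N i)) \<and>
     (\<forall>J\<subseteq>I. J \<noteq> {} \<longrightarrow> finite J \<longrightarrow> (\<forall>A. (\<forall>j\<in>J. A j \<in> sets (N j)) \<longrightarrow>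
        (AE \<omega> in M. cond_probability M F (\<Inter>j\<in>J. Z j -` A j \<inter> space M) \<omega> =
                     (\<Prod>j\<in>J. cond_probability M F (Z j -` A j \<inter> space M) \<omega>))))"

text \<open>\<open>p j\<close> is a version of \<open>x \<mapsto> P(Y\<^sub>j = 1 | X = x)\<close>.\<close>

definition cond_label_probs ::
  "'a measure \<Rightarrow> ('a \<Rightarrow> real ^ 'n::finite) \<Rightarrow> ('a \<Rightarrow> real ^ 'n) \<Rightarrow> ('n \<Rightarrow> real ^ 'n \<Rightarrow> real) \<Rightarrow> bool"
where
  "cond_label_probs M X Y p \<longleftrightarrow>
     (\<forall>j. p j \<in> borel_measurable borel \<and>
       (AE \<omega> in M. p j (X \<omega>) =
          cond_probability M (sigma_gen M X) {\<omega> \<in> space M. Y \<omega> $ j = 1} \<omega>))"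

text \<open>The law of a sum of independent Bernoulli variables with success probabilities \<open>q j\<close>, \<open>j \<in> A\<close>.
  Note that \<open>bernoulli_pmf\<close> truncates its parameter to the unit interval; a version of a conditional
  probability leaves that interval only on a null set.\<close>

definition poisson_binomial_pmf :: "'i set \<Rightarrow> ('i \<Rightarrow> real) \<Rightarrow> nat pmf" where
  "poisson_binomial_pmf A q =
     map_pmf (\<lambda>b. \<Sum>j\<in>A. of_bool (b j)) (Pi_pmf A False (\<lambda>j. bernoulli_pmf (q j)))"

definition top_set :: "('n::finite \<Rightarrow> real) \<Rightarrow> nat \<Rightarrow> 'n set" where
  "top_set q \<tau> = {j. (\<Sum>k\<in>UNIV. of_bool (q k \<ge> q j)) \<le> \<tau>}"

definition volume_objective :: "real \<Rightarrow> ('n::finite \<Rightarrow> real) \<Rightarrow> nat \<Rightarrow> real" where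
  "volume_objective \<gamma> q \<tau> =
     (\<Sum>j\<in>top_set q \<tau>. \<Sum>l\<in>{0..CARD('n) - 1}.
        2 / (real \<tau> + real l + \<gamma> + 1) * q j * pmf (poisson_binomial_pmf (UNIV - {j}) q) l)
     + (\<Sum>l\<in>{0..CARD('n)}. \<gamma> / (real \<tau> + real l + \<gamma>) * pmf (poisson_binomial_pmf UNIV q) l)"

definition is_optimal_volume :: "real \<Rightarrow> ('n::finite \<Rightarrow> real) \<Rightarrow> nat \<Rightarrow> bool" where
  "is_optimal_volume \<gamma> q = is_arg_max (volume_objective \<gamma> q) (\<lambda>\<tau>. \<tau> \<in> {0..CARD('n)})"

end

theory Submission
  imports Defs
begin

text \<open>Conditioning on \<open>X = x\<close> makes the labels independent Bernoulli variables, so the Dice metric of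
  a rule is the mean over \<open>x\<close> of a function of the segmented set \<open>S\<close> alone. For fixed \<open>|S|\<close> this
  function is an additive constant plus a sum over \<open>j \<in> S\<close> of the weights
  \<open>p\<^sub>j E[2 / (|S| + \<Gamma>\<^bsub>-j\<^esub> + 1 + \<gamma>)]\<close>. Conditioning additionally on the labels \<open>i\<close> and \<open>j\<close> shows that
  the difference of two weights is \<open>p\<^sub>j - p\<^sub>i\<close> times a positive number; hence the top set is the
  unique best set of its size, and only the size remains to be optimised. Since there are
  finitely many sets \<open>S\<close>, a rule is globally optimal iff almost every \<open>x\<close> is segmented
  optimally.\<close>

section \<open>Independent Bernoulli labels and Poisson-binomial sums\<close>

abbreviation label_pmf :: "'i set \<Rightarrow> ('i \<Rightarrow> real) \<Rightarrow> ('i \<Rightarrow> bool) pmf" where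
  "label_pmf A q \<equiv> Pi_pmf A False (\<lambda>j. bernoulli_pmf (q j))"

definition dice_ratio :: "real \<Rightarrow> ('i::finite \<Rightarrow> bool) \<Rightarrow> 'i set \<Rightarrow> real" where
  "dice_ratio \<gamma> b S =
    (2 * (\<Sum>j\<in>S. of_bool (b j)) + \<gamma>) / ((\<Sum>j\<in>UNIV. of_bool (b j)) + real (card S) + \<gamma>)"

text \<open>The product is written with \<open>q j\<close> rather than \<open>bernoulli_pmf (q j)\<close>: this is visibly measurable
  in \<open>q\<close>, and the two agree for \<open>q j\<close> in the unit interval.\<close>

definition cond_dice :: "real \<Rightarrow> ('i::finite \<Rightarrow> real) \<Rightarrow> 'i set \<Rightarrow> real" where
  "cond_dice \<gamma> q S = (\<Sum>b\<in>UNIV. (\<Prod>j\<in>UNIV. if b j then q j else 1 - q j) * dice_ratio \<gamma> b S)"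

text \<open>Draw label \<open>j\<close> first: the product law splits into a Bernoulli choice for
  \<open>j\<close> and the law on \<open>A\<close>. The bounds on \<open>q j\<close> make
  \<open>bernoulli_pmf\<close>, which truncates its parameter, give exactly the weights
  \<open>q j\<close> and \<open>1 - q j\<close>.\<close>

lemma expectation_label_pmf_insert:
  fixes q :: "'i::finite \<Rightarrow> real" and h :: "('i \<Rightarrow> bool) \<Rightarrow> real"
  assumes "j \<notin> A" "0 \<le> q j" "q j \<le> 1"
  shows "measure_pmf.expectation (label_pmf (insert j A) q) h =
    q j * measure_pmf.expectation (label_pmf A q) (\<lambda>b. h (b(j := True))) +
    (1 - q j) * measure_pmf.expectation (label_pmf A q) (\<lambda>b. h (b(j := False)))"
proof -
  have eq: "label_pmf (insert j A) q =
      bernoulli_pmf (q j) \<bind> (\<lambda>y. map_pmf (\<lambda>b. b(j := y)) (label_pmf A q))"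
    using assms(1) by (subst Pi_pmf_insert') (simp_all add: map_pmf_def)
  show ?thesis
    unfolding eq using assms(2,3) by (subst pmf_expectation_bind[of UNIV]) (auto simp: UNIV_bool)
qed

lemma expectation_poisson_binomial:
  "measure_pmf.expectation (poisson_binomial_pmf A q) h =
    measure_pmf.expectation (label_pmf A q) (\<lambda>b. h (\<Sum>j\<in>A. of_bool (b j)))" for h :: "nat \<Rightarrow> real"
  by (simp add: poisson_binomial_pmf_def)

text \<open>A sum of \<open>card A\<close> indicators never exceeds \<open>n\<close>, so the range
  of summation covers the support. This turns the sums in \<open>volume_objective\<close> into
  expectations.\<close>

lemma sum_pmf_poisson_binomial:
  assumes "finite A" "card A \<le> n"
  shows "(\<Sum>l\<in>{0..n}. h l * pmf (poisson_binomial_pmf A q) l) =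
    measure_pmf.expectation (poisson_binomial_pmf A q) h"
proof (rule integral_measure_pmf_real[symmetric])
  fix l assume "l \<in> set_pmf (poisson_binomial_pmf A q)"
  then obtain b where "l = (\<Sum>j\<in>A. of_bool (b j))" by (auto simp: poisson_binomial_pmf_def)
  also have "\<dots> \<le> of_nat (card A) * 1" by (intro sum_bounded_above) auto
  finally show "l \<in> {0..n}" using assms by simp
qed simp

lemma expectation_poisson_binomial_insert:
  fixes q :: "'i::finite \<Rightarrow> real" and h :: "nat \<Rightarrow> real"
  assumes "j \<notin> A" "0 \<le> q j" "q j \<le> 1"
  shows "measure_pmf.expectation (poisson_binomial_pmf (insert j A) q) h =
    q j * measure_pmf.expectation (poisson_binomial_pmf A q) (\<lambda>l. h (Suc l)) +
    (1 - q j) * measure_pmf.expectation (poisson_binomial_pmf A q) h"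
proof -
  have "(\<Sum>k\<in>A. of_bool ((b(j := v)) k)) = (\<Sum>k\<in>A. of_bool (b k) :: nat)" for b :: "'i \<Rightarrow> bool" and v
    using assms(1) by (intro sum.cong) auto
  then show ?thesis
    using assms by (simp add: expectation_poisson_binomial expectation_label_pmf_insert
        del: sum_of_bool_eq)
qed

text \<open>When label \<open>j\<close> is one, it adds one to the total, and the sum of the other
  labels is independent of it. This is the source of the extra 1 in the denominators of
  \<open>volume_objective\<close>.\<close>

lemma expectation_label_poisson_binomial:
  fixes q :: "'i::finite \<Rightarrow> real" and h :: "nat \<Rightarrow> real"
  assumes "0 \<le> q j" "q j \<le> 1"
  shows "measure_pmf.expectation (label_pmf UNIV q) (\<lambda>b. of_bool (b j) * h (\<Sum>k\<in>UNIV. of_bool (b k))) =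
    q j * measure_pmf.expectation (poisson_binomial_pmf (UNIV - {j}) q) (\<lambda>l. h (Suc l))"
proof -
  have U: "UNIV = insert j (UNIV - {j})" by auto
  have *: "(\<Sum>k\<in>UNIV. of_bool ((b(j := True)) k)) = Suc (\<Sum>k\<in>UNIV-{j}. of_bool (b k))" for b :: "'i \<Rightarrow> bool"
    by (subst sum.remove[of _ j]) (auto intro!: sum.cong)
  show ?thesis
    by (subst U, subst expectation_label_pmf_insert)
      (use assms * in \<open>simp_all add: expectation_poisson_binomial del: sum_of_bool_eq\<close>)
qed

section \<open>Splitting the conditional Dice value into weights\<close>

text \<open>Expected contribution of segmenting \<open>j\<close> at volume \<tau>. The volume is an
  argument separate from the set, so that labels can be compared at one fixed volume.\<close>

definition label_weight :: "real \<Rightarrow> ('i::finite \<Rightarrow> real) \<Rightarrow> nat \<Rightarrow> 'i \<Rightarrow> real" where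
  "label_weight \<gamma> q \<tau> j =
    q j * measure_pmf.expectation (poisson_binomial_pmf (UNIV - {j}) q) (\<lambda>l. 2 / (real \<tau> + real (Suc l) + \<gamma>))"

text \<open>The share of the smoothing term in the numerator; it cancels when sets of equal size are
  compared.\<close>

definition base_weight :: "real \<Rightarrow> ('i::finite \<Rightarrow> real) \<Rightarrow> nat \<Rightarrow> real" where
  "base_weight \<gamma> q \<tau> =
    measure_pmf.expectation (poisson_binomial_pmf UNIV q) (\<lambda>l. \<gamma> / (real \<tau> + real l + \<gamma>))"

lemma volume_objective_eq:
  "volume_objective \<gamma> q \<tau> = (\<Sum>j\<in>top_set q \<tau>. label_weight \<gamma> q \<tau> j) + base_weight \<gamma> q \<tau>"
  unfolding volume_objective_def label_weight_def base_weight_def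
  by (simp add: sum_pmf_poisson_binomial[symmetric, where n = "CARD('a) - 1"]
      sum_pmf_poisson_binomial[symmetric, where n = "CARD('a)"] sum_distrib_left ac_simps card_Diff_singleton)

lemma cond_dice_expectation:
  assumes "\<And>j. 0 \<le> q j \<and> q j \<le> 1"
  shows "cond_dice \<gamma> q S = measure_pmf.expectation (label_pmf UNIV q) (\<lambda>b. dice_ratio \<gamma> b S)"
proof -
  have "(\<Prod>j\<in>UNIV. if b j then q j else 1 - q j) = pmf (label_pmf UNIV q) b" for b
    using assms by (subst pmf_Pi') (auto intro!: prod.cong)
  then show ?thesis
    unfolding cond_dice_def by (subst integral_measure_pmf_real[of UNIV]) (auto simp: mult.commute)
qed

text \<open>The denominator of \<open>dice_ratio\<close> sees \<open>S\<close> only through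
  \<open>card S\<close> and the labels only through their number, so by linearity the numerator
  splits into one term per segmented label and the smoothing term.\<close>

lemma cond_dice_eq:
  assumes "\<And>j. 0 \<le> q j \<and> q j \<le> 1"
  shows "cond_dice \<gamma> q S = (\<Sum>j\<in>S. label_weight \<gamma> q (card S) j) + base_weight \<gamma> q (card S)"
proof -
  let ?h = "\<lambda>l. 2 / (real (card S) + real l + \<gamma>)"
  let ?N = "\<lambda>b. (\<Sum>k\<in>UNIV. of_bool (b k)) :: nat"
  have int: "integrable (measure_pmf (label_pmf UNIV q)) f" for f :: "_ \<Rightarrow> real"
    by (intro integrable_measure_pmf_finite) simp
  have "dice_ratio \<gamma> b S = (\<Sum>j\<in>S. of_bool (b j) * ?h (?N b)) + \<gamma> / (real (card S) + real (?N b) + \<gamma>)" for b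
    unfolding dice_ratio_def sum_distrib_right[symmetric]
    by (simp add: add_divide_distrib ac_simps)
  then have "cond_dice \<gamma> q S =
      (\<Sum>j\<in>S. measure_pmf.expectation (label_pmf UNIV q) (\<lambda>b. of_bool (b j) * ?h (?N b))) +
      measure_pmf.expectation (label_pmf UNIV q) (\<lambda>b. \<gamma> / (real (card S) + real (?N b) + \<gamma>))"
    by (simp only: cond_dice_expectation[OF assms] Bochner_Integration.integral_add[OF int int]
        Bochner_Integration.integral_sum[OF int])
  then show ?thesis
    using assms by (simp only: expectation_label_poisson_binomial[of q _ ?h] label_weight_def base_weight_def
        expectation_poisson_binomial[of UNIV])
qed

section \<open>Ranking of labels and optimal sets for fixed probabilities\<close>

lemma label_weight_less:
  assumes "\<And>j. 0 \<le> q j \<and> q j \<le> 1" "\<gamma> \<ge> 0" "q i < q j"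
  shows "label_weight \<gamma> q \<tau> i < label_weight \<gamma> q \<tau> j"
proof -
  let ?C = "UNIV - {i, j}"
  let ?h = "\<lambda>l. 2 / (real \<tau> + real (Suc l) + \<gamma>)"
  let ?E = "\<lambda>h. measure_pmf.expectation (poisson_binomial_pmf ?C q) h"
  have ij: "i \<noteq> j" using assms by auto
  \<comment> \<open>Each weight is expanded over the other label, leaving the same sum over
    \<open>?C\<close>; all terms carrying \<open>q i * q j\<close> then cancel in the
    difference.\<close>
  have wi: "label_weight \<gamma> q \<tau> i = q i * (q j * ?E (\<lambda>l. ?h (Suc l)) + (1 - q j) * ?E ?h)"
  proof -
    have *: "UNIV - {i} = insert j ?C" using ij by auto
    show ?thesis unfolding label_weight_def *
      by (subst expectation_poisson_binomial_insert) (use assms in auto)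
  qed
  have wj: "label_weight \<gamma> q \<tau> j = q j * (q i * ?E (\<lambda>l. ?h (Suc l)) + (1 - q i) * ?E ?h)"
  proof -
    have *: "UNIV - {j} = insert i ?C" using ij by auto
    show ?thesis unfolding label_weight_def *
      by (subst expectation_poisson_binomial_insert) (use assms in auto)
  qed
  have fin: "finite (set_pmf (poisson_binomial_pmf ?C q))"
    by (simp add: poisson_binomial_pmf_def)
  \<comment> \<open>The \<open>Suc\<close> keeps every denominator at least 1, also for
    \<open>\<tau> = 0\<close> and \<open>\<gamma> = 0\<close>.\<close>
  have "?E ?h > 0"
    using assms(2) by (intro measure_pmf.expectation_greater integrable_measure_pmf_finite fin)
      (auto intro!: AE_pmfI divide_pos_pos)
  then have "0 < (q j - q i) * ?E ?h" using assms(3) by simp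
  also have "\<dots> = label_weight \<gamma> q \<tau> j - label_weight \<gamma> q \<tau> i"
    unfolding wi wj by (simp add: algebra_simps)
  finally show ?thesis by simp
qed

text \<open>The rank \<open>r j\<close> starts at 1 because \<open>j\<close> counts itself. Without
  ties the ranks are distinct and hence exhaust \<open>{1..CARD('i)}\<close>, and the top set is the
  preimage of the ranks up to \<tau>.\<close>

lemma card_top_set:
  fixes q :: "'i::finite \<Rightarrow> real"
  assumes "inj q" "\<tau> \<le> CARD('i)"
  shows "card (top_set q \<tau>) = \<tau>"
proof -
  define r where "r j = (\<Sum>k\<in>UNIV. of_bool (q k \<ge> q j) :: nat)" for j
  have r: "r j = card {k. q k \<ge> q j}" for j
    by (simp add: r_def Collect_conj_eq)
  have mono: "r j < r i" if "q i < q j" for i j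
    unfolding r using that
    by (intro psubset_card_mono psubsetI) (auto simp: set_eq_iff intro!: exI[of _ i])
  have "inj r"
    using mono assms(1) unfolding inj_def by (metis less_irrefl linorder_neqE_linordered_idom)
  moreover have "r ` UNIV \<subseteq> {1..CARD('i)}"
    unfolding r by (auto simp: card_gt_0_iff Suc_le_eq intro!: card_mono)
  ultimately have "r ` UNIV = {1..CARD('i)}"
    by (intro card_subset_eq) (auto simp: card_image)
  then have "r ` (r -` {1..\<tau>}) = {1..\<tau>}" using assms(2) by (intro image_vimage_eq[THEN trans]) auto
  moreover have "top_set q \<tau> = r -` {1..\<tau>}"
    using \<open>r ` UNIV \<subseteq> _\<close> by (force simp: top_set_def r_def[symmetric])
  ultimately show ?thesis
    by (metis \<open>inj r\<close> card_atLeastAtMost card_image diff_Suc_1 inj_on_subset subset_UNIV)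
qed

lemma top_set_less:
  assumes "i \<in> top_set q \<tau>" "j \<notin> top_set q \<tau>"
  shows "q j < q i"
proof (rule ccontr)
  assume "\<not> q j < q i"
  then have "(\<Sum>k\<in>UNIV. of_bool (q k \<ge> q j)) \<le> (\<Sum>k\<in>UNIV. of_bool (q k \<ge> q i) :: nat)"
    by (intro sum_mono) auto
  then show False using assms by (auto simp: top_set_def)
qed

text \<open>Exchange argument: \<open>S\<close> and the top set of its size have equally many
  elements outside each other. Any bijection between these replaces each label by a strictly more
  probable one, hence a heavier one, and the common part cancels.\<close>

lemma sum_label_weight_less_top_set:
  assumes q: "\<And>j. 0 \<le> q j \<and> q j \<le> 1" and "\<gamma> \<ge> 0" "inj q" "S \<noteq> top_set q (card S)"
  shows "(\<Sum>j\<in>S. label_weight \<gamma> q \<tau> j) < (\<Sum>j\<in>top_set q (card S). label_weight \<gamma> q \<tau> j)"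
proof -
  let ?T = "top_set q (card S)"
  have card: "card ?T = card S" using assms(3) by (simp add: card_top_set card_mono)
  then have "card (S - ?T) = card (?T - S)"
    by (metis card_Diff_subset_Int finite Int_commute)
  then obtain f where f: "bij_betw f (S - ?T) (?T - S)"
    by (metis finite finite_same_card_bij)
  have ne: "S - ?T \<noteq> {}" using assms(4) card by (metis Diff_eq_empty_iff card_subset_eq finite)
  have "(\<Sum>j\<in>S - ?T. label_weight \<gamma> q \<tau> j) < (\<Sum>j\<in>S - ?T. label_weight \<gamma> q \<tau> (f j))"
  proof (rule sum_strict_mono)
    fix j assume j: "j \<in> S - ?T"
    then have "f j \<in> ?T" using f by (auto simp: bij_betw_def)
    then show "label_weight \<gamma> q \<tau> j < label_weight \<gamma> q \<tau> (f j)"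
      using j by (intro label_weight_less q assms(2) top_set_less[of _ q "card S"]) auto
  qed (use ne in auto)
  also have "\<dots> = (\<Sum>j\<in>?T - S. label_weight \<gamma> q \<tau> j)"
    by (rule sum.reindex_bij_betw[OF f])
  finally show ?thesis
    using sum.Int_Diff[of S "label_weight \<gamma> q \<tau>" ?T] sum.Int_Diff[of ?T "label_weight \<gamma> q \<tau>" S]
    by (simp add: Int_commute)
qed

lemma cond_dice_top_set:
  fixes q :: "'i::finite \<Rightarrow> real"
  assumes "\<And>j. 0 \<le> q j \<and> q j \<le> 1" "inj q" "\<tau> \<le> CARD('i)"
  shows "cond_dice \<gamma> q (top_set q \<tau>) = volume_objective \<gamma> q \<tau>"
  using assms by (simp add: cond_dice_eq volume_objective_eq card_top_set)

text \<open>Each set is bounded by the objective at its own size, strictly unless it is the top set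
  of that size, and top sets attain the objective at every admissible volume. Optimal volumes may
  tie, hence the existential quantifier.\<close>

lemma cond_dice_maximal_iff:
  fixes q :: "'i::finite \<Rightarrow> real"
  assumes q: "\<And>j. 0 \<le> q j \<and> q j \<le> 1" and \<gamma>: "\<gamma> \<ge> 0" and inj: "inj q"
  shows "(\<forall>T. cond_dice \<gamma> q T \<le> cond_dice \<gamma> q S) \<longleftrightarrow>
    (\<exists>\<tau>. is_optimal_volume \<gamma> q \<tau> \<and> S = top_set q \<tau>)"
proof -
  have card: "card T \<le> CARD('i)" for T :: "'i set" by (simp add: card_mono)
  have less: "cond_dice \<gamma> q T < volume_objective \<gamma> q (card T)" if "T \<noteq> top_set q (card T)" for T
    using sum_label_weight_less_top_set[OF q \<gamma> inj that]
    by (simp add: cond_dice_eq[OF q] volume_objective_eq)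
  have le: "cond_dice \<gamma> q T \<le> volume_objective \<gamma> q (card T)" for T
    using less[of T] cond_dice_top_set[OF q inj card, of \<gamma> T] by (cases "T = top_set q (card T)") auto
  show ?thesis
  proof
    assume max: "\<forall>T. cond_dice \<gamma> q T \<le> cond_dice \<gamma> q S"
    have *: "volume_objective \<gamma> q \<tau> \<le> cond_dice \<gamma> q S" if "\<tau> \<le> CARD('i)" for \<tau>
      using max cond_dice_top_set[OF q inj that] by metis
    \<comment> \<open>Otherwise \<open>less\<close> would put the value of \<open>S\<close> strictly
      below the objective at \<open>card S\<close>, against \<open>*\<close>.\<close>
    have S: "S = top_set q (card S)" using less[of S] *[OF card, of S] by force
    moreover have "is_optimal_volume \<gamma> q (card S)"
      unfolding is_optimal_volume_def is_arg_max_linorder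
      using * le[of S] card[of S] by (force intro: order_trans)
    ultimately show "\<exists>\<tau>. is_optimal_volume \<gamma> q \<tau> \<and> S = top_set q \<tau>" by blast
  next
    assume "\<exists>\<tau>. is_optimal_volume \<gamma> q \<tau> \<and> S = top_set q \<tau>"
    then obtain \<tau> where \<tau>: "is_optimal_volume \<gamma> q \<tau>" "S = top_set q \<tau>" by blast
    then have "\<tau> \<le> CARD('i)" by (simp add: is_optimal_volume_def is_arg_max_linorder)
    then show "\<forall>T. cond_dice \<gamma> q T \<le> cond_dice \<gamma> q S"
      using le card \<tau> cond_dice_top_set[OF q inj, of \<tau> \<gamma>]
      unfolding is_optimal_volume_def is_arg_max_linorder by (metis atLeastAtMost_iff order_trans zero_le)
  qed
qed

text \<open>Finitely many candidates; maximizing is minimizing the negative. This provides an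
  optimal volume even at points of the exceptional null set.\<close>

lemma is_optimal_volume_exists:
  fixes q :: "'a::finite \<Rightarrow> real"
  shows "\<exists>\<tau>. is_optimal_volume \<gamma> q \<tau>"
  using ex_is_arg_min_if_finite[of "{0..CARD('a)}" "\<lambda>\<tau>. - volume_objective \<gamma> q \<tau>"]
  by (auto simp: is_optimal_volume_def is_arg_max_linorder is_arg_min_linorder)


section \<open>Binary vectors as label sets\<close>

definition label_set :: "real ^ 'n::finite \<Rightarrow> 'n set" where
  "label_set v = {j. v $ j = 1}"

lemma measurable_component [measurable (raw)]:
  fixes f :: "'a \<Rightarrow> real ^ 'n::finite"
  assumes "f \<in> borel_measurable M"
  shows "(\<lambda>x. f x $ j) \<in> borel_measurable M"
  by (rule measurable_compose[OF assms])
    (intro borel_measurable_continuous_onI linear_continuous_on bounded_linear_vec_nth)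

lemma measurable_finite_count_space:
  fixes f :: "'a \<Rightarrow> 'b::finite"
  assumes "\<And>y. {x \<in> space M. f x = y} \<in> sets M"
  shows "f \<in> M \<rightarrow>\<^sub>M count_space UNIV"
  using assms by (subst measurable_count_space_eq2) (auto simp: vimage_def Int_def conj_commute)

lemma measurable_label_set [measurable]: "label_set \<in> borel \<rightarrow>\<^sub>M count_space UNIV"
proof (rule measurable_finite_count_space)
  fix S :: "'a set"
  have "{v \<in> space borel. \<forall>j. (v $ j = 1) = (j \<in> S)} \<in> sets (borel :: (real ^ 'a) measure)"
    by measurable
  then show "{v \<in> space borel. label_set v = S} \<in> sets borel"
    by (simp add: label_set_def set_eq_iff)
qed

lemma dice_integrand:
  assumes "y \<in> binary_vectors" "s \<in> binary_vectors"
  shows "(2 * (y \<bullet> s) + \<gamma>) / (l1_norm y + l1_norm s + \<gamma>) = dice_ratio \<gamma> (\<lambda>j. y $ j = 1) (label_set s)"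
proof -
  have y: "y $ j = of_bool (y $ j = 1)" and s: "s $ j = of_bool (j \<in> label_set s)" for j
    using assms by (auto simp: binary_vectors_def label_set_def)
  have "y \<bullet> s = (\<Sum>j\<in>UNIV. of_bool (y $ j = 1) * of_bool (j \<in> label_set s))"
    unfolding inner_vec_def using y s by (metis (no_types, lifting) inner_real_def sum.cong)
  also have "\<dots> = (\<Sum>j\<in>label_set s. of_bool (y $ j = 1))"
    by (intro sum.mono_neutral_cong_right) auto
  finally have 1: "y \<bullet> s = (\<Sum>j\<in>label_set s. of_bool (y $ j = 1))" .
  have 2: "l1_norm y = (\<Sum>j\<in>UNIV. of_bool (y $ j = 1))"
    unfolding l1_norm_def by (intro sum.cong refl) (subst y, simp)
  have 3: "l1_norm s = real (card (label_set s))"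
  proof -
    have "l1_norm s = (\<Sum>j\<in>UNIV. of_bool (j \<in> label_set s))"
      unfolding l1_norm_def by (intro sum.cong refl) (subst s, simp)
    then show ?thesis by simp
  qed
  show ?thesis unfolding dice_ratio_def 1 2 3 ..
qed

section \<open>Integrating out the labels given the features\<close>

text \<open>Split along the finitely many values of \<open>Z\<close>: where \<open>Z = b\<close> the
  integrand is the \<open>F\<close>-measurable \<open>R b\<close>, which can be pulled out of the
  conditional expectation of the indicator. \<open>W b\<close> is any a.e. version of the
  conditional probability, so an explicit formula in \<open>p\<close> can be inserted.\<close>

lemma integral_finite_valued_cond:
  fixes Z :: "'a \<Rightarrow> 'i::finite" and R :: "'i \<Rightarrow> 'a \<Rightarrow> real"
  assumes "prob_space M" "subalgebra M F"
    and Z: "Z \<in> M \<rightarrow>\<^sub>M count_space UNIV"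
    and R: "\<And>b. R b \<in> borel_measurable F" "\<And>b. integrable M (R b)"
    and W: "\<And>b. W b \<in> borel_measurable M"
      "\<And>b. AE \<omega> in M. cond_probability M F {\<omega> \<in> space M. Z \<omega> = b} \<omega> = W b \<omega>"
  shows "integrable M (\<lambda>\<omega>. \<Sum>b\<in>UNIV. W b \<omega> * R b \<omega>)"
    and "(LINT \<omega>|M. R (Z \<omega>) \<omega>) = (LINT \<omega>|M. (\<Sum>b\<in>UNIV. W b \<omega> * R b \<omega>))"
proof -
  interpret prob_space M by fact
  interpret finite_measure_subalgebra M F by standard fact
  define I where "I b = indicat_real {\<omega> \<in> space M. Z \<omega> = b}" for b
  have ev: "{\<omega> \<in> space M. Z \<omega> = b} \<in> sets M" for b
    using Z by measurable
  then have I: "I b \<in> borel_measurable M" for b unfolding I_def by measurable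
  have RI: "integrable M (\<lambda>\<omega>. R b \<omega> * I b \<omega>)" for b
    unfolding I_def using integrable_mult_indicator[OF ev R(2)] by (simp add: mult.commute)
  have R_M: "R b \<in> borel_measurable M" for b using R(2) by auto
  have ae: "AE \<omega> in M. R b \<omega> * real_cond_exp M F (I b) \<omega> = W b \<omega> * R b \<omega>" for b
    using W(2)[of b] by eventually_elim (simp add: cond_probability_def I_def)
  have int: "integrable M (\<lambda>\<omega>. W b \<omega> * R b \<omega>)" for b
    using integrable_cong_AE[OF _ _ ae[of b]] real_cond_exp_intg(1)[OF RI R(1) I, of b] R_M W(1)
    by auto
  then show "integrable M (\<lambda>\<omega>. \<Sum>b\<in>UNIV. W b \<omega> * R b \<omega>)" by simp
  have "(LINT \<omega>|M. R (Z \<omega>) \<omega>) = (LINT \<omega>|M. (\<Sum>b\<in>UNIV. R b \<omega> * I b \<omega>))"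
    by (intro Bochner_Integration.integral_cong) (auto simp: I_def indicator_def if_distrib cong: if_cong)
  also have "\<dots> = (\<Sum>b\<in>UNIV. LINT \<omega>|M. R b \<omega> * real_cond_exp M F (I b) \<omega>)"
    by (simp add: RI real_cond_exp_intg(2)[OF RI R(1) I])
  also have "\<dots> = (\<Sum>b\<in>UNIV. LINT \<omega>|M. W b \<omega> * R b \<omega>)"
    using R_M W(1) by (intro sum.cong refl integral_cong_AE ae) auto
  also have "\<dots> = (LINT \<omega>|M. (\<Sum>b\<in>UNIV. W b \<omega> * R b \<omega>))"
    by (simp add: int)
  finally show "(LINT \<omega>|M. R (Z \<omega>) \<omega>) = \<dots>" .
qed

locale segmentation_model = prob_space M
  for M :: "'a measure" +
  fixes X Y :: "'a \<Rightarrow> real ^ 'n::finite" and p :: "'n \<Rightarrow> real ^ 'n \<Rightarrow> real" and \<gamma> :: real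
  assumes X [measurable]: "X \<in> borel_measurable M"
    and Y [measurable]: "Y \<in> borel_measurable M"
    and Y_binary: "\<omega> \<in> space M \<Longrightarrow> Y \<omega> \<in> binary_vectors"
    and indep: "cond_indep_vars M (sigma_gen M X) (\<lambda>j. borel) (\<lambda>j \<omega>. Y \<omega> $ j) UNIV"
    and probs: "cond_label_probs M X Y p"
begin

lemma measurable_p [measurable]: "p j \<in> borel_measurable borel"
  using probs by (simp add: cond_label_probs_def)

lemma subalgebra_X: "subalgebra M (sigma_gen M X)"
  unfolding subalgebra_def sigma_gen_def using measurable_sets[OF X]
  by (auto simp: sets_vimage_algebra2)

lemma measurable_X: "X \<in> borel_measurable (sigma_gen M X)"
  unfolding sigma_gen_def by (rule measurable_vimage_algebra1) simp

sublocale finite_measure_subalgebra M "sigma_gen M X"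
  by standard (rule subalgebra_X)

text \<open>Conditional expectation preserves the bounds 0 and 1 of an indicator. This supplies the
  range condition of the fixed-probability lemmas off a null set.\<close>

lemma AE_p_range: "AE \<omega> in M. \<forall>j. 0 \<le> p j (X \<omega>) \<and> p j (X \<omega>) \<le> 1"
proof (rule eventually_all_finite)
  fix j
  let ?I = "indicat_real {\<omega> \<in> space M. Y \<omega> $ j = 1}"
  have "{\<omega> \<in> space M. Y \<omega> $ j = 1} \<in> sets M" by measurable
  then have I: "integrable M ?I" by (intro integrable_const_bound[where B = 1]) auto
  show "AE \<omega> in M. 0 \<le> p j (X \<omega>) \<and> p j (X \<omega>) \<le> 1"
    using probs[unfolded cond_label_probs_def, rule_format, of j, THEN conjunct2]
      real_cond_exp_ge_c[OF I, of 0] real_cond_exp_le_c[OF I, of 1]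
    unfolding cond_probability_def by (auto simp: indicator_def)
qed

text \<open>A label pattern is an intersection of one event per coordinate, so conditional
  independence of the whole family factorizes its probability. As labels are binary, label 0 is the
  complement of label 1, which gives the factor \<open>1 - p j (X \<omega>)\<close>.\<close>

lemma AE_cond_probability_labels:
  "AE \<omega> in M. cond_probability M (sigma_gen M X) {\<omega> \<in> space M. (\<lambda>j. Y \<omega> $ j = 1) = b} \<omega> =
    (\<Prod>j\<in>UNIV. if b j then p j (X \<omega>) else 1 - p j (X \<omega>))"
proof -
  let ?P = "cond_probability M (sigma_gen M X)"
  define A where "A j = {if b j then 1 else 0 :: real}" for j
  have 1: "AE \<omega> in M. ?P ((\<lambda>\<omega>. Y \<omega> $ j) -` A j \<inter> space M) \<omega> =
      (if b j then p j (X \<omega>) else 1 - p j (X \<omega>))" for j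
  proof -
    let ?I = "indicat_real {\<omega> \<in> space M. Y \<omega> $ j = 1}"
    have pj: "AE \<omega> in M. p j (X \<omega>) = real_cond_exp M (sigma_gen M X) ?I \<omega>"
      using probs by (simp add: cond_label_probs_def cond_probability_def)
    show ?thesis
    proof (cases "b j")
      case True
      then have "(\<lambda>\<omega>. Y \<omega> $ j) -` A j \<inter> space M = {\<omega> \<in> space M. Y \<omega> $ j = 1}" by (auto simp: A_def)
      then show ?thesis using pj True by (auto simp: cond_probability_def)
    next
      case False
      have ev: "{\<omega> \<in> space M. Y \<omega> $ j = 1} \<in> sets M" by measurable
      then have I: "integrable M ?I" by (intro integrable_const_bound[where B = 1]) auto
      let ?J = "indicat_real ((\<lambda>\<omega>. Y \<omega> $ j) -` A j \<inter> space M)"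
      have "(\<lambda>\<omega>. Y \<omega> $ j) -` A j \<inter> space M \<in> sets M"
        by (rule measurable_sets[of _ _ borel], measurable) (simp add: A_def)
      then have J: "?J \<in> borel_measurable M" by measurable
      have "?J \<omega> = 1 - ?I \<omega>" if "\<omega> \<in> space M" for \<omega>
        using Y_binary[OF that] that False by (auto simp: A_def binary_vectors_def indicator_def)
      then have "AE \<omega> in M. ?J \<omega> = 1 - ?I \<omega>" by (rule AE_I2)
      then have "AE \<omega> in M. real_cond_exp M (sigma_gen M X) ?J \<omega> =
          real_cond_exp M (sigma_gen M X) (\<lambda>\<omega>. 1 - ?I \<omega>) \<omega>"
        by (rule real_cond_exp_cong) (use J ev in auto)
      moreover have "AE \<omega> in M. real_cond_exp M (sigma_gen M X) (\<lambda>\<omega>. 1 - ?I \<omega>) \<omega> =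
          real_cond_exp M (sigma_gen M X) (\<lambda>\<omega>. 1) \<omega> - real_cond_exp M (sigma_gen M X) ?I \<omega>"
        by (rule real_cond_exp_diff) (use I in simp_all)
      moreover have "AE \<omega> in M. real_cond_exp M (sigma_gen M X) (\<lambda>\<omega>. 1) \<omega> = 1"
        by (rule real_cond_exp_F_meas) simp_all
      ultimately show ?thesis using pj unfolding cond_probability_def
        by eventually_elim (simp add: False)
    qed
  qed
  have eq: "(\<Inter>j\<in>UNIV. (\<lambda>\<omega>. Y \<omega> $ j) -` A j \<inter> space M) =
      {\<omega> \<in> space M. (\<lambda>j. Y \<omega> $ j = 1) = b}"
    using Y_binary by (force simp: A_def binary_vectors_def fun_eq_iff split: if_splits)
  have "AE \<omega> in M. ?P (\<Inter>j\<in>UNIV. (\<lambda>\<omega>. Y \<omega> $ j) -` A j \<inter> space M) \<omega> =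
      (\<Prod>j\<in>UNIV. ?P ((\<lambda>\<omega>. Y \<omega> $ j) -` A j \<inter> space M) \<omega>)"
    using indep unfolding cond_indep_vars_def by (auto simp: A_def)
  moreover have "AE \<omega> in M. \<forall>j. ?P ((\<lambda>\<omega>. Y \<omega> $ j) -` A j \<inter> space M) \<omega> =
      (if b j then p j (X \<omega>) else 1 - p j (X \<omega>))"
    using 1 by (rule eventually_all_finite)
  ultimately show ?thesis
    unfolding eq by eventually_elim simp
qed

abbreviation rule_dice :: "(real ^ 'n \<Rightarrow> real ^ 'n) \<Rightarrow> real ^ 'n \<Rightarrow> real" where
  "rule_dice \<delta> x \<equiv> cond_dice \<gamma> (\<lambda>j. p j x) (label_set (\<delta> x))"

text \<open>Given \<open>X\<close> the segmented set is fixed, so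
  \<open>integral_finite_valued_cond\<close> applies with the label pattern as \<open>Z\<close>;
  averaging \<open>dice_ratio\<close> over the patterns yields \<open>cond_dice\<close>.\<close>

lemma
  assumes "segmentation_rule \<delta>"
  shows integrable_rule_dice: "integrable M (\<lambda>\<omega>. rule_dice \<delta> (X \<omega>))"
    and dice_eq: "dice M X Y \<gamma> \<delta> = (LINT \<omega>|M. rule_dice \<delta> (X \<omega>))"
proof -
  have \<delta> [measurable]: "\<delta> \<in> borel_measurable borel" and bin: "\<delta> x \<in> binary_vectors" for x
    using assms by (auto simp: segmentation_rule_def)
  let ?F = "sigma_gen M X"
  define R where "R b \<omega> = dice_ratio \<gamma> b (label_set (\<delta> (X \<omega>)))" for b \<omega>
  define W where "W b \<omega> = (\<Prod>j\<in>UNIV. if b j then p j (X \<omega>) else 1 - p j (X \<omega>))" for b \<omega>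
  define Z where "Z \<omega> = (\<lambda>j. Y \<omega> $ j = 1)" for \<omega>
  have Z: "Z \<in> M \<rightarrow>\<^sub>M count_space UNIV"
  proof (rule measurable_finite_count_space)
    fix b
    have "{\<omega> \<in> space M. \<forall>j. (Y \<omega> $ j = 1) = b j} \<in> sets M" by measurable
    then show "{\<omega> \<in> space M. Z \<omega> = b} \<in> sets M" by (simp add: Z_def fun_eq_iff)
  qed
  have R: "R b \<in> borel_measurable ?F" for b
  proof -
    have "(\<lambda>x. dice_ratio \<gamma> b (label_set (\<delta> x))) \<in> borel_measurable borel" by measurable
    then show ?thesis unfolding R_def by (rule measurable_compose[OF measurable_X])
  qed
  \<comment> \<open>For fixed \<open>b\<close> there are only finitely many sets \<open>S\<close>,
    which gives the bound.\<close>
  have int: "integrable M (R b)" for b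
  proof (rule integrable_const_bound[where B = "Max (range (\<lambda>S. \<bar>dice_ratio \<gamma> b S\<bar>))"])
    show "AE \<omega> in M. norm (R b \<omega>) \<le> Max (range (\<lambda>S. \<bar>dice_ratio \<gamma> b S\<bar>))"
      by (intro AE_I2) (auto simp: R_def)
    show "R b \<in> borel_measurable M" by (rule measurable_from_subalg[OF subalgebra_X R])
  qed
  have W: "W b \<in> borel_measurable M" for b unfolding W_def by measurable
  have WP: "AE \<omega> in M. cond_probability M ?F {\<omega> \<in> space M. Z \<omega> = b} \<omega> = W b \<omega>" for b
    unfolding Z_def W_def by (rule AE_cond_probability_labels)
  note * = integral_finite_valued_cond[of M ?F Z R W, OF prob_space_axioms subalgebra_X Z R int W WP]
  have eq: "(\<Sum>b\<in>UNIV. W b \<omega> * R b \<omega>) = rule_dice \<delta> (X \<omega>)" for \<omega>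
    by (simp add: W_def R_def cond_dice_def)
  show "integrable M (\<lambda>\<omega>. rule_dice \<delta> (X \<omega>))" using *(1) unfolding eq .
  have "dice M X Y \<gamma> \<delta> = (LINT \<omega>|M. R (Z \<omega>) \<omega>)"
    unfolding dice_def R_def Z_def
    by (intro Bochner_Integration.integral_cong refl dice_integrand Y_binary bin)
  then show "dice M X Y \<gamma> \<delta> = (LINT \<omega>|M. rule_dice \<delta> (X \<omega>))" using *(2) unfolding eq by simp
qed

section \<open>Global versus pointwise maximality\<close>

lemma measurable_cond_dice [measurable]:
  assumes [measurable]: "f \<in> borel \<rightarrow>\<^sub>M count_space UNIV"
  shows "(\<lambda>x. cond_dice \<gamma> (\<lambda>j. p j x) (f x)) \<in> borel_measurable borel"
  unfolding cond_dice_def by measurable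

text \<open>A pointwise improvement \<open>T\<close> on the set where \<open>T\<close> beats \<open>\<delta>\<close> gives a measurable competitor,
  so no measurable selection of the optimal volume is required.\<close>

lemma AE_maximal_if_is_arg_max:
  assumes max: "is_arg_max (dice M X Y \<gamma>) segmentation_rule \<delta>"
  shows "AE \<omega> in M. \<forall>T. cond_dice \<gamma> (\<lambda>j. p j (X \<omega>)) T \<le> rule_dice \<delta> (X \<omega>)"
proof (rule eventually_all_finite)
  fix T :: "'n set"
  have seg: "segmentation_rule \<delta>" using max by (simp add: is_arg_max_linorder)
  then have [measurable]: "\<delta> \<in> borel_measurable borel" by (simp add: segmentation_rule_def)
  define \<delta>' where "\<delta>' x =
    (if rule_dice \<delta> x < cond_dice \<gamma> (\<lambda>j. p j x) T then \<chi> j. of_bool (j \<in> T) else \<delta> x)" for x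
  have "\<delta>' \<in> borel_measurable borel" unfolding \<delta>'_def by measurable
  then have seg': "segmentation_rule \<delta>'"
    using seg by (auto simp: segmentation_rule_def \<delta>'_def binary_vectors_def)
  have "label_set (\<chi> j. of_bool (j \<in> T)) = T" by (auto simp: label_set_def)
  \<comment> \<open>The gain of \<open>\<delta>'\<close> is the positive part of the gain of
    \<open>T\<close>: it is nonnegative, and it vanishes exactly where \<open>T\<close> does not
    beat \<delta>.\<close>
  then have eq: "rule_dice \<delta>' x - rule_dice \<delta> x = max 0 (cond_dice \<gamma> (\<lambda>j. p j x) T - rule_dice \<delta> x)" for x
    by (simp add: \<delta>'_def)
  have nonneg: "rule_dice \<delta> x \<le> rule_dice \<delta>' x" for x
    using eq[of x] by linarith
  note int = integrable_rule_dice[OF seg'] integrable_rule_dice[OF seg]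
  have "(LINT \<omega>|M. rule_dice \<delta>' (X \<omega>) - rule_dice \<delta> (X \<omega>)) = dice M X Y \<gamma> \<delta>' - dice M X Y \<gamma> \<delta>"
    by (simp add: dice_eq seg seg' int)
  also have "\<dots> \<le> 0" using max seg' by (simp add: is_arg_max_linorder)
  finally have "(LINT \<omega>|M. rule_dice \<delta>' (X \<omega>) - rule_dice \<delta> (X \<omega>)) = 0"
    by (intro antisym integral_nonneg_AE) (auto simp: eq)
  then have "AE \<omega> in M. rule_dice \<delta>' (X \<omega>) - rule_dice \<delta> (X \<omega>) = 0"
    by (subst (asm) integral_nonneg_eq_0_iff_AE) (auto simp: int nonneg)
  then show "AE \<omega> in M. cond_dice \<gamma> (\<lambda>j. p j (X \<omega>)) T \<le> rule_dice \<delta> (X \<omega>)"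
    by eventually_elim (simp add: eq max_def split: if_splits)
qed

text \<open>Take for \<open>T\<close> the set that a competitor segments at
  \<open>X \<omega>\<close>; then the integrands compare a.e.\<close>

lemma is_arg_max_if_AE_maximal:
  assumes seg: "segmentation_rule \<delta>"
    and "AE \<omega> in M. \<forall>T. cond_dice \<gamma> (\<lambda>j. p j (X \<omega>)) T \<le> rule_dice \<delta> (X \<omega>)"
  shows "is_arg_max (dice M X Y \<gamma>) segmentation_rule \<delta>"
  unfolding is_arg_max_linorder
proof (intro conjI allI impI seg)
  fix \<delta>' :: "real ^ 'n \<Rightarrow> real ^ 'n"
  assume seg': "segmentation_rule \<delta>'"
  show "dice M X Y \<gamma> \<delta>' \<le> dice M X Y \<gamma> \<delta>"
    unfolding dice_eq[OF seg] dice_eq[OF seg']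
    using assms(2) by (intro integral_mono_AE integrable_rule_dice seg seg') auto
qed

end

theorem theorem1:
  fixes M :: "'a measure"
    and X Y :: "'a \<Rightarrow> real ^ 'n::finite"
    and p :: "'n \<Rightarrow> real ^ 'n \<Rightarrow> real"
    and \<gamma> :: real
    and \<delta>opt :: "real ^ 'n \<Rightarrow> real ^ 'n"
  assumes "prob_space M"
    and "\<gamma> \<ge> 0"
    and "X \<in> borel_measurable M"
    and "Y \<in> borel_measurable M"
    and "\<And>\<omega>. \<omega> \<in> space M \<Longrightarrow> Y \<omega> \<in> binary_vectors"
    and "cond_indep_vars M (sigma_gen M X) (\<lambda>j. borel) (\<lambda>j \<omega>. Y \<omega> $ j) UNIV"
    and "cond_label_probs M X Y p"
    and "AE \<omega> in M. inj (\<lambda>j. p j (X \<omega>))"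
    and "segmentation_rule \<delta>opt"
  shows "is_arg_max (dice M X Y \<gamma>) segmentation_rule \<delta>opt \<longleftrightarrow>
    (\<exists>\<tau>opt :: real ^ 'n \<Rightarrow> nat.
       (\<forall>x. is_optimal_volume \<gamma> (\<lambda>j. p j x) (\<tau>opt x)) \<and>
       (AE x in distr M borel X. \<forall>j.
          \<delta>opt x $ j = (if j \<in> top_set (\<lambda>j. p j x) (\<tau>opt x) then 1 else 0)))"
proof -
  interpret segmentation_model M X Y p \<gamma>
    using assms by (simp add: segmentation_model_def segmentation_model_axioms_def)
  have [measurable]: "\<delta>opt \<in> borel_measurable borel" and bin: "\<delta>opt x \<in> binary_vectors" for x
    using assms(9) by (auto simp: segmentation_rule_def)
  have pointwise: "(\<forall>j. \<delta>opt x $ j = (if j \<in> S then 1 else 0)) \<longleftrightarrow> label_set (\<delta>opt x) = S" for x S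
    using bin[of x] by (force simp: label_set_def binary_vectors_def split: if_splits)
  let ?max = "\<lambda>x. \<forall>T. cond_dice \<gamma> (\<lambda>j. p j x) T \<le> rule_dice \<delta>opt x"
  let ?opt = "\<lambda>x \<tau>. is_optimal_volume \<gamma> (\<lambda>j. p j x) \<tau>"
  \<comment> \<open>Injectivity is written out as finitely many comparisons of Borel functions, so
    that the event is visibly measurable.\<close>
  let ?good = "\<lambda>x. (\<forall>j. 0 \<le> p j x \<and> p j x \<le> 1) \<and> (\<forall>i j. p i x = p j x \<longrightarrow> i = j)"
  have good: "AE \<omega> in M. ?good (X \<omega>)"
    using AE_p_range assms(8) by eventually_elim (simp add: inj_def)
  have max_iff: "?max x \<longleftrightarrow> (\<exists>\<tau>. ?opt x \<tau> \<and> label_set (\<delta>opt x) = top_set (\<lambda>j. p j x) \<tau>)" if "?good x" for x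
    using that assms(2) by (intro cond_dice_maximal_iff) (auto simp: inj_def)
  show ?thesis
    unfolding pointwise
  proof
    assume "is_arg_max (dice M X Y \<gamma>) segmentation_rule \<delta>opt"
    then have "AE \<omega> in M. ?max (X \<omega>) \<and> ?good (X \<omega>)"
      using AE_maximal_if_is_arg_max good by auto
    \<comment> \<open>The transfer to the law of \<open>X\<close> precedes the choice of volumes:
      this event is given by finitely many Borel conditions, whereas measurability of the \<tau>
      chosen below is not established.\<close>
    then have "AE x in distr M borel X. ?max x \<and> ?good x"
      by (subst AE_distr_iff) measurable
    \<comment> \<open>As optimal volumes may tie, \<tau> must follow the rule: it picks an optimal
      volume matching the segmented set whenever one exists. The fallback keeps \<tau> optimal at
      every remaining point.\<close>
    moreover define \<tau> where "\<tau> x = (if \<exists>\<tau>. ?opt x \<tau> \<and> label_set (\<delta>opt x) = top_set (\<lambda>j. p j x) \<tau>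
      then SOME \<tau>. ?opt x \<tau> \<and> label_set (\<delta>opt x) = top_set (\<lambda>j. p j x) \<tau> else SOME \<tau>. ?opt x \<tau>)" for x
    have "?opt x (\<tau> x)" for x
      unfolding \<tau>_def by (smt (verit) is_optimal_volume_exists someI_ex)
    moreover have "label_set (\<delta>opt x) = top_set (\<lambda>j. p j x) (\<tau> x)" if "?max x \<and> ?good x" for x
      using max_iff[of x] that unfolding \<tau>_def by (smt (verit, ccfv_threshold) someI_ex)
    ultimately show "\<exists>\<tau>. (\<forall>x. ?opt x (\<tau> x)) \<and>
        (AE x in distr M borel X. label_set (\<delta>opt x) = top_set (\<lambda>j. p j x) (\<tau> x))"
      by (intro exI[of _ \<tau>] conjI allI) (auto elim: eventually_mono)
  next
    assume "\<exists>\<tau>. (\<forall>x. ?opt x (\<tau> x)) \<and>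
        (AE x in distr M borel X. label_set (\<delta>opt x) = top_set (\<lambda>j. p j x) (\<tau> x))"
    then obtain \<tau> where \<tau>: "\<And>x. ?opt x (\<tau> x)"
      and "AE x in distr M borel X. label_set (\<delta>opt x) = top_set (\<lambda>j. p j x) (\<tau> x)" by blast
    \<comment> \<open>Pulling an a.e. statement back along \<open>X\<close> requires only
      measurability of \<open>X\<close>, so \<tau> may be arbitrary here.\<close>
    then have "AE \<omega> in M. label_set (\<delta>opt (X \<omega>)) = top_set (\<lambda>j. p j (X \<omega>)) (\<tau> (X \<omega>))"
      by (intro AE_distrD[OF assms(3)])
    with good have "AE \<omega> in M. ?max (X \<omega>)"
      by eventually_elim (use max_iff \<tau> in blast)
    then show "is_arg_max (dice M X Y \<gamma>) segmentation_rule \<delta>opt"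
      by (rule is_arg_max_if_AE_maximal[OF assms(9)])
  qed
qed

end
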